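(* Let $F$ be a hereditary family of graphs. Assume there exists an $O(f(n))$-time algorithm which, given a graph $G\in F$ (with $n$ vertices) and a vertex $v\in V(G)$, decides whether $v$ is a shedding vertex of $G$. Then deciding for an input well-covered graph $G\in F$ whether $G\in\mathbf{W_2}$ can be done in $O(n f(n))$ time.
   Context: Graphs are finite, simple, undirected; $n=|V(G)|$; $N(v)$ is the neighbourhood of $v$ and $N[v]=N(v)\cup\{v\}$. A family $F$ is hereditary if every induced subgraph of a graph in $F$ belongs to $F$. A set is independent if its vertices are pairwise nonadjacent; maximal if not properly contained in another independent set; maximum if no independent set is larger. $\alpha(G)$ is the size of a maximum independent set; $G$ is well-covered if all maximal independent sets have size $\alpha(G)$. $G\in\mathbf{W_2}$ if every two disjoint independent sets of $G$ are contained in two disjoint maximum independent sets. A vertex $v$ is shedding if for every independent set $S\subseteq V(G)\setminus N[v]$ there exists $u\in N(v)$ such that $S\cup\{u\}$ is independent. *)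

theory Defs
  imports Complex_Main "HOL-Library.Landau_Symbols"
begin

section \<open>Graphs\<close>

type_synonym 'a ugraph = "'a set \<times> 'a set set"

abbreviation verts :: "'a ugraph \<Rightarrow> 'a set" where "verts G \<equiv> fst G"
abbreviation edges :: "'a ugraph \<Rightarrow> 'a set set" where "edges G \<equiv> snd G"

definition simple_graph :: "'a ugraph \<Rightarrow> bool" where
  "simple_graph G \<longleftrightarrow> finite (verts G) \<and> (\<forall>e \<in> edges G. e \<subseteq> verts G \<and> card e = 2)"

definition adjacent :: "'a ugraph \<Rightarrow> 'a \<Rightarrow> 'a \<Rightarrow> bool" where
  "adjacent G u v \<longleftrightarrow> {u, v} \<in> edges G"

definition nbhd :: "'a ugraph \<Rightarrow> 'a \<Rightarrow> 'a set" where
  "nbhd G v = {u \<in> verts G. adjacent G u v}"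

definition closed_nbhd :: "'a ugraph \<Rightarrow> 'a \<Rightarrow> 'a set" where
  "closed_nbhd G v = insert v (nbhd G v)"

definition induced_subgraph :: "'a ugraph \<Rightarrow> 'a set \<Rightarrow> 'a ugraph" where
  "induced_subgraph G U = (U, {e \<in> edges G. e \<subseteq> U})"

definition hereditary :: "'a ugraph set \<Rightarrow> bool" where
  "hereditary F \<longleftrightarrow> (\<forall>G \<in> F. \<forall>U \<subseteq> verts G. induced_subgraph G U \<in> F)"

definition independent :: "'a ugraph \<Rightarrow> 'a set \<Rightarrow> bool" where
  "independent G S \<longleftrightarrow> S \<subseteq> verts G \<and> (\<forall>u \<in> S. \<forall>v \<in> S. u \<noteq> v \<longrightarrow> \<not> adjacent G u v)"

definition maximal_independent :: "'a ugraph \<Rightarrow> 'a set \<Rightarrow> bool" where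
  "maximal_independent G S \<longleftrightarrow> independent G S \<and> \<not> (\<exists>T. independent G T \<and> S \<subset> T)"

definition maximum_independent :: "'a ugraph \<Rightarrow> 'a set \<Rightarrow> bool" where
  "maximum_independent G S \<longleftrightarrow> independent G S \<and> (\<forall>T. independent G T \<longrightarrow> card T \<le> card S)"

definition independence_number :: "'a ugraph \<Rightarrow> nat" where
  "independence_number G = Max (card ` {S. independent G S})"

definition well_covered :: "'a ugraph \<Rightarrow> bool" where
  "well_covered G \<longleftrightarrow> (\<forall>S. maximal_independent G S \<longrightarrow> card S = independence_number G)"

definition W2 :: "'a ugraph \<Rightarrow> bool" where
  "W2 G \<longleftrightarrow> (\<forall>A B. independent G A \<and> independent G B \<and> A \<inter> B = {} \<longrightarrow>
     (\<exists>I J. maximum_independent G I \<and> maximum_independent G J \<and> I \<inter> J = {} \<and>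
            A \<subseteq> I \<and> B \<subseteq> J))"

definition shedding :: "'a ugraph \<Rightarrow> 'a \<Rightarrow> bool" where
  "shedding G v \<longleftrightarrow> v \<in> verts G \<and>
     (\<forall>S. independent G S \<and> S \<subseteq> verts G - closed_nbhd G v \<longrightarrow>
          (\<exists>u \<in> nbhd G v. independent G (insert u S)))"


section \<open>Algorithms and running time\<close>

text \<open>
  Algorithms are structured programs for a word random access machine.  A program uses finitely
  many registers and finitely many arrays of unbounded length (both named by natural numbers),
  all holding natural numbers.  Every instruction and every test takes one unit of time.
\<close>

datatype arith_op = Add | Sub | Mul | Div

fun arith :: "arith_op \<Rightarrow> nat \<Rightarrow> nat \<Rightarrow> nat" where
  "arith Add m n = m + n"
| "arith Sub m n = m - n"
| "arith Mul m n = m * n"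
| "arith Div m n = m div n"

datatype com =
    Skip
  | Const nat nat              \<comment> \<open>\<open>Const x c\<close>: \<open>x := c\<close>\<close>
  | Arith nat arith_op nat nat \<comment> \<open>\<open>Arith x p y z\<close>: \<open>x := y p z\<close>\<close>
  | Load nat nat nat           \<comment> \<open>\<open>Load x a y\<close>: \<open>x := a[y]\<close>\<close>
  | Store nat nat nat          \<comment> \<open>\<open>Store a x y\<close>: \<open>a[x] := y\<close>\<close>
  | Seq com com
  | If nat com com             \<comment> \<open>tests whether the register is nonzero\<close>
  | While nat com

type_synonym state = "(nat \<Rightarrow> nat) \<times> (nat \<Rightarrow> nat \<Rightarrow> nat)"

text \<open>
  \<open>exec W c s t s'\<close>: started in \<open>s\<close> (registers and arrays), \<open>c\<close> terminates in \<open>s'\<close> after exactly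
  \<open>t\<close> steps.  Every number created must be smaller than \<open>W\<close>; on overflow there is no execution,
  so unit-cost multiplication cannot be abused to compute with huge numbers.
\<close>

inductive exec :: "nat \<Rightarrow> com \<Rightarrow> state \<Rightarrow> nat \<Rightarrow> state \<Rightarrow> bool" for W :: nat where
  Skip: "exec W Skip s 1 s"
| Const: "c < W \<Longrightarrow> exec W (Const x c) (r, m) 1 (r(x := c), m)"
| Arith: "arith p (r y) (r z) < W \<Longrightarrow>
    exec W (Arith x p y z) (r, m) 1 (r(x := arith p (r y) (r z)), m)"
| Load: "exec W (Load x a y) (r, m) 1 (r(x := m a (r y)), m)"
| Store: "exec W (Store a x y) (r, m) 1 (r, m(a := (m a)(r x := r y)))"
| Seq: "exec W c1 s t1 s' \<Longrightarrow> exec W c2 s' t2 s'' \<Longrightarrow> exec W (Seq c1 c2) s (t1 + t2) s''"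
| IfTrue: "fst s x \<noteq> 0 \<Longrightarrow> exec W c1 s t s' \<Longrightarrow> exec W (If x c1 c2) s (t + 1) s'"
| IfFalse: "fst s x = 0 \<Longrightarrow> exec W c2 s t s' \<Longrightarrow> exec W (If x c1 c2) s (t + 1) s'"
| WhileFalse: "fst s x = 0 \<Longrightarrow> exec W (While x c) s 1 s"
| WhileTrue: "fst s x \<noteq> 0 \<Longrightarrow> exec W c s t1 s' \<Longrightarrow> exec W (While x c) s' t2 s'' \<Longrightarrow>
    exec W (While x c) s (t1 + t2 + 1) s''"

text \<open>Executions are unique, so the existential quantifier over executions below is harmless.\<close>

inductive_cases exec_SkipE: "exec W Skip s t s'"
inductive_cases exec_ConstE: "exec W (Const x c) s t s'"
inductive_cases exec_ArithE: "exec W (Arith x p y z) s t s'"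
inductive_cases exec_LoadE: "exec W (Load x a y) s t s'"
inductive_cases exec_StoreE: "exec W (Store a x y) s t s'"
inductive_cases exec_SeqE: "exec W (Seq c1 c2) s t s'"
inductive_cases exec_IfE: "exec W (If x c1 c2) s t s'"
inductive_cases exec_WhileE: "exec W (While x c) s t s'"

lemma exec_deterministic:
  "exec W c s t s' \<Longrightarrow> exec W c s u s'' \<Longrightarrow> u = t \<and> s'' = s'"
proof (induction arbitrary: u s'' rule: exec.induct)
  case (Skip s)
  then show ?case by (auto elim: exec_SkipE)
next
  case (Const c x r m)
  from Const.prems show ?case by (auto elim: exec_ConstE)
next
  case (Arith p r y z x m)
  from Arith.prems show ?case by (auto elim: exec_ArithE)
next
  case (Load x a y r m)
  then show ?case by (auto elim: exec_LoadE)
next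
  case (Store a x y r m)
  then show ?case by (auto elim: exec_StoreE)
next
  case (Seq c1 s t1 s1 c2 t2 s2)
  from Seq.prems obtain v1 v2 q
    where "exec W c1 s v1 q" "exec W c2 q v2 s''" "u = v1 + v2"
    by (rule exec_SeqE)
  with Seq.IH show ?case by metis
next
  case (IfTrue s x c1 t s1 c2)
  from IfTrue.prems IfTrue.hyps(1) obtain v where "exec W c1 s v s''" "u = v + 1"
    by (auto elim: exec_IfE)
  with IfTrue.IH show ?case by metis
next
  case (IfFalse s x c2 t s1 c1)
  from IfFalse.prems IfFalse.hyps(1) obtain v where "exec W c2 s v s''" "u = v + 1"
    by (auto elim: exec_IfE)
  with IfFalse.IH show ?case by metis
next
  case (WhileFalse s x c)
  from WhileFalse.prems WhileFalse.hyps show ?case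
    by (auto elim: exec_WhileE)
next
  case (WhileTrue s x c t1 s1 t2 s2)
  from WhileTrue.prems WhileTrue.hyps(1) obtain v1 v2 q
    where "exec W c s v1 q" "exec W (While x c) q v2 s''" "u = v1 + v2 + 1"
    by (auto elim: exec_WhileE)
  with WhileTrue.IH show ?case by metis
qed

text \<open>
  A decision problem is a set of instances: size, initial state and correct answer.  It is
  solvable in time \<open>O(g)\<close> if one program, with words of \<open>O(log n)\<close> bits (all numbers below
  \<open>(n + 2) ^ k\<close> for a constant \<open>k\<close>), halts on every instance of size \<open>n\<close> within \<open>T n\<close> steps with
  the answer in register 0, where \<open>T\<close> is \<open>O(g)\<close>.  Nothing is required of the program on states
  that are not instances.
\<close>

type_synonym decision_problem = "(nat \<times> state \<times> bool) set"

definition solvable_in_time :: "decision_problem \<Rightarrow> (nat \<Rightarrow> real) \<Rightarrow> bool" where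
  "solvable_in_time \<Pi> g \<longleftrightarrow> (\<exists>P k T. (\<lambda>n. real (T n)) \<in> O(g) \<and>
     (\<forall>(n, s, b) \<in> \<Pi>. \<exists>t s'. exec ((n + 2) ^ k) P s t s' \<and> t \<le> T n \<and> (fst s' 0 \<noteq> 0 \<longleftrightarrow> b)))"


section \<open>Graphs as inputs\<close>

text \<open>
  The vertices of an input graph are numbered \<open>0, \<dots>, n - 1\<close> by their positions in an arbitrary
  enumeration \<open>vs\<close> of the vertex set.  In the adjacency list format, cell \<open>i \<le> n\<close> holds the address
  at which the neighbour list of vertex \<open>i\<close> begins (for \<open>i = n\<close>: at which the last list ends), and
  the neighbour lists, each in arbitrary order, follow one another from cell \<open>n + 1\<close> on.
\<close>

definition array_of :: "nat list \<Rightarrow> nat \<Rightarrow> nat" where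
  "array_of xs = (\<lambda>k. if k < length xs then xs ! k else 0)"

datatype graph_format = Adjacency_Matrix | Adjacency_Lists

definition enumerates :: "'a list \<Rightarrow> 'a ugraph \<Rightarrow> bool" where
  "enumerates vs G \<longleftrightarrow> distinct vs \<and> set vs = verts G"

fun represents :: "graph_format \<Rightarrow> 'a ugraph \<Rightarrow> 'a list \<Rightarrow> (nat \<Rightarrow> nat) \<Rightarrow> bool" where
  "represents Adjacency_Matrix G vs A \<longleftrightarrow>
     A = array_of (concat (map (\<lambda>u. map (\<lambda>v. of_bool (adjacent G u v)) vs) vs))"
| "represents Adjacency_Lists G vs A \<longleftrightarrow>
     (\<exists>ls. length ls = length vs \<and>
        (\<forall>i < length vs. distinct (ls ! i) \<and>
           set (ls ! i) = {j. j < length vs \<and> adjacent G (vs ! i) (vs ! j)}) \<and>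
        A = array_of (map (\<lambda>i. length vs + 1 + length (concat (take i ls))) [0..<length vs + 1]
                      @ concat ls))"

text \<open>Scalar inputs are in registers 0, 1, ... and the graph is in array 0; all else is zero.\<close>

definition initial_state :: "nat list \<Rightarrow> (nat \<Rightarrow> nat) \<Rightarrow> state" where
  "initial_state xs A = (array_of xs, (\<lambda>a i. 0)(0 := A))"

definition shedding_problem :: "graph_format \<Rightarrow> 'a ugraph set \<Rightarrow> decision_problem" where
  "shedding_problem fmt F =
     {(card (verts G), initial_state [card (verts G), i] A, shedding G (vs ! i)) | G vs A i.
        G \<in> F \<and> enumerates vs G \<and> represents fmt G vs A \<and> i < length vs}"

definition W2_problem :: "graph_format \<Rightarrow> 'a ugraph set \<Rightarrow> decision_problem" where
  "W2_problem fmt F =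
     {(card (verts G), initial_state [card (verts G)] A, W2 G) | G vs A.
        G \<in> F \<and> enumerates vs G \<and> represents fmt G vs A}"

end

theory Submission
  imports Defs
begin

text \<open>
  A well-covered graph is in \<open>W\<^sub>2\<close> iff all its vertices are shedding.  If \<open>v\<close> is not
  shedding, witnessed by \<open>S\<close>, then every maximum independent set containing \<open>S\<close> contains \<open>v\<close>, so
  \<open>S\<close> and \<open>{v}\<close> cannot be separated.  Conversely, extend two disjoint independent sets to a disjoint
  independent pair \<open>I\<close>, \<open>J\<close> of largest total size: if \<open>I\<close> were not maximal it could be extended by
  some \<open>v \<in> J\<close> only, but then also by a neighbour of \<open>v\<close>, which cannot lie in \<open>J\<close>.

  It remains to run the given shedding test once for each vertex.  The test may overwrite its memory,
  and there is no time to copy the input graph before each run or to clean up cell by cell.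
  Instead every written cell is stamped with the number of the run, and a read from a cell whose
  stamp is out of date returns the initial content.  This costs a constant factor only.
\<close>

section \<open>Shedding vertices of well-covered graphs\<close>

lemma independent_subset: "independent G S \<Longrightarrow> T \<subseteq> S \<Longrightarrow> independent G T"
  by (auto simp: independent_def)

lemma finite_independent: "simple_graph G \<Longrightarrow> independent G S \<Longrightarrow> finite S"
  by (auto simp: simple_graph_def independent_def intro: finite_subset)

lemma adjacent_sym: "adjacent G u v \<longleftrightarrow> adjacent G v u"
  by (simp add: adjacent_def insert_commute)

lemma not_adjacent_self: "simple_graph G \<Longrightarrow> \<not> adjacent G v v"
  by (auto simp: adjacent_def simple_graph_def)

lemma independent_insert:
  "independent G (insert v S) \<longleftrightarrow>
     v \<in> verts G \<and> independent G S \<and> (\<forall>u \<in> S. u \<noteq> v \<longrightarrow> \<not> adjacent G u v)"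
  by (auto simp: independent_def adjacent_sym)

text \<open>Separating a violating \<open>S\<close> from \<open>{v}\<close> gives a maximum
  independent set \<open>I\<close> containing \<open>S\<close> but not \<open>v\<close>. No
  neighbour \<open>u\<close> of \<open>v\<close> lies in \<open>I\<close>, since
  \<open>insert u S\<close> would be independent; hence \<open>v\<close> can be added to
  \<open>I\<close>, against maximality.\<close>

lemma W2_imp_shedding:
  assumes G: "simple_graph G" and W: "W2 G" and v: "v \<in> verts G"
  shows "shedding G v"
  unfolding shedding_def
proof (intro conjI v allI impI, elim conjE, rule ccontr)
  fix S
  assume S: "independent G S" "S \<subseteq> verts G - closed_nbhd G v"
    and no: "\<not> (\<exists>u \<in> nbhd G v. independent G (insert u S))"
  have "independent G {v}" "S \<inter> {v} = {}"
    using v S(2) by (auto simp: independent_def closed_nbhd_def)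
  then obtain I J where I: "maximum_independent G I" "S \<subseteq> I" and J: "{v} \<subseteq> J" "I \<inter> J = {}"
    using W S(1) unfolding W2_def by meson
  have ind: "independent G I"
    using I(1) by (simp add: maximum_independent_def)
  have "\<not> adjacent G u v" if "u \<in> I" for u
  proof
    assume "adjacent G u v"
    with that ind have "u \<in> nbhd G v"
      by (auto simp: nbhd_def independent_def)
    moreover have "independent G (insert u S)"
      using independent_subset[OF ind] that I(2) by simp
    ultimately show False
      using no by blast
  qed
  with ind v have "independent G (insert v I)"
    by (simp add: independent_insert)
  then have "card (insert v I) \<le> card I"
    using I(1) by (simp add: maximum_independent_def)
  moreover have "v \<notin> I"
    using J by auto
  ultimately show False
    using finite_independent[OF G ind] by simp
qed

text \<open>Finiteness of the vertex set makes \<open>independence_number\<close> a genuine maximum,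
  so a set of that size bounds every independent set.\<close>

lemma well_covered_maximum:
  assumes G: "simple_graph G" and wc: "well_covered G" and S: "maximal_independent G S"
  shows "maximum_independent G S"
proof -
  have "{T. independent G T} \<subseteq> Pow (verts G)"
    by (auto simp: independent_def)
  then have "finite (card ` {T. independent G T})"
    using G by (meson finite_Pow_iff finite_imageI finite_subset simple_graph_def)
  with wc S show ?thesis
    by (auto simp: well_covered_def maximum_independent_def maximal_independent_def
        independence_number_def)
qed

text \<open>
  Stated for one component only, so that it applies to \<open>I\<close> and, by symmetry, to \<open>J\<close>.
\<close>

lemma maximal_if_largest_disjoint_pair:
  assumes G: "simple_graph G" and shed: "\<And>v. v \<in> verts G \<Longrightarrow> shedding G v"
    and I: "independent G I" and J: "independent G J" and disj: "I \<inter> J = {}"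
    and largest: "\<And>I'. independent G I' \<Longrightarrow> I \<subseteq> I' \<Longrightarrow> I' \<inter> J = {} \<Longrightarrow> card I' \<le> card I"
  shows "maximal_independent G I"
proof (rule ccontr)
  \<comment> \<open>A vertex outside both sets that can be added to \<open>I\<close> would give a
    larger set still disjoint from \<open>J\<close>.\<close>
  have no: "w \<in> I \<or> w \<in> J" if "independent G (insert w I)" for w
    using largest[OF that] disj finite_independent[OF G I] by (fastforce simp: card_insert_if)
  assume "\<not> maximal_independent G I"
  then obtain T where T: "independent G T" "I \<subset> T"
    using I by (auto simp: maximal_independent_def)
  then obtain v where v: "v \<in> T" "v \<notin> I"
    by blast
  have indv: "independent G (insert v I)"
    by (rule independent_subset[OF T(1)]) (use T v in auto)
  with no v have vJ: "v \<in> J"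
    by blast
  have "I \<subseteq> verts G - closed_nbhd G v"
    using indv I v by (auto simp: independent_insert closed_nbhd_def nbhd_def independent_def)
  moreover have "shedding G v"
    using shed indv by (simp add: independent_insert)
  ultimately obtain u where u: "u \<in> nbhd G v" "independent G (insert u I)"
    using I by (auto simp: shedding_def)
  \<comment> \<open>\<open>v\<close> lies in the independent set \<open>J\<close> and is adjacent to
    \<open>u\<close>.\<close>
  have "u \<notin> J"
    using u(1) J vJ not_adjacent_self[OF G] by (metis independent_def mem_Collect_eq nbhd_def)
  moreover have "u \<notin> I"
    using u(1) indv not_adjacent_self[OF G] by (auto simp: nbhd_def independent_insert)
  ultimately show False
    using no[OF u(2)] by blast
qed

lemma W2_iff_shedding:
  assumes G: "simple_graph G" and wc: "well_covered G"
  shows "W2 G \<longleftrightarrow> (\<forall>v \<in> verts G. shedding G v)"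
proof
  assume shed: "\<forall>v \<in> verts G. shedding G v"
  show "W2 G"
    unfolding W2_def
  proof (intro allI impI, elim conjE)
    fix A B
    assume AB: "independent G A" "independent G B" "A \<inter> B = {}"
    \<comment> \<open>The competing pairs extending \<open>(A, B)\<close>: finitely many, so one has
      largest total size. Keeping one component fixed, the other is then largest as well.\<close>
    define \<P> where "\<P> = {(I, J). independent G I \<and> independent G J \<and> I \<inter> J = {} \<and> A \<subseteq> I \<and> B \<subseteq> J}"
    define total where "total = (\<lambda>(I :: 'a set, J :: 'a set). card I + card J)"
    have "\<P> \<subseteq> Pow (verts G) \<times> Pow (verts G)"
      by (auto simp: \<P>_def independent_def)
    then have "finite \<P>"
      using G by (meson finite_Pow_iff finite_SigmaI finite_subset simple_graph_def)
    moreover have "(A, B) \<in> \<P>"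
      using AB by (simp add: \<P>_def)
    ultimately have "Max (total ` \<P>) \<in> total ` \<P>"
      by (intro Max_in) auto
    then obtain I J where IJ: "(I, J) \<in> \<P>" "total (I, J) = Max (total ` \<P>)"
      by auto
    have largest: "card I' + card J' \<le> card I + card J" if "(I', J') \<in> \<P>" for I' J'
    proof -
      have "total (I', J') \<le> Max (total ` \<P>)"
        using \<open>finite \<P>\<close> that by (intro Max_ge finite_imageI imageI)
      then show ?thesis
        unfolding IJ(2)[symmetric] by (simp add: total_def)
    qed
    have IJ': "independent G I" "independent G J" "I \<inter> J = {}" "A \<subseteq> I" "B \<subseteq> J"
      using IJ(1) by (auto simp: \<P>_def)
    have "maximal_independent G I"
    proof (rule maximal_if_largest_disjoint_pair[OF G _ IJ'(1-3)])
      show "card I' \<le> card I" if "independent G I'" "I \<subseteq> I'" "I' \<inter> J = {}" for I'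
        using largest[of I' J] that IJ' by (simp add: \<P>_def)
    qed (use shed in blast)
    moreover have "maximal_independent G J"
    proof (rule maximal_if_largest_disjoint_pair[OF G _ IJ'(2,1)])
      show "card J' \<le> card J" if "independent G J'" "J \<subseteq> J'" "J' \<inter> I = {}" for J'
        using largest[of I J'] that IJ' by (simp add: \<P>_def Int_commute)
    qed (use shed IJ' in blast)+
    ultimately show "\<exists>I J. maximum_independent G I \<and> maximum_independent G J \<and> I \<inter> J = {} \<and>
        A \<subseteq> I \<and> B \<subseteq> J"
      using IJ' well_covered_maximum[OF G wc] by blast
  qed
qed (use W2_imp_shedding[OF G] in blast)

section \<open>Restartable simulation of a program\<close>

text \<open>The instruction rules of \<open>exec\<close> need the state as an explicit pair; these
  four variants accept any state term.\<close>

lemma exec_Const: "c < W \<Longrightarrow> exec W (Const x c) s 1 ((fst s)(x := c), snd s)"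
  using exec.Const[of c W x "fst s" "snd s"] by simp

lemma exec_Arith:
  "arith p (fst s y) (fst s z) < W \<Longrightarrow>
     exec W (Arith x p y z) s 1 ((fst s)(x := arith p (fst s y) (fst s z)), snd s)"
  using exec.Arith[of p "fst s" y z W x "snd s"] by simp

lemma exec_Load: "exec W (Load x a y) s 1 ((fst s)(x := snd s a (fst s y)), snd s)"
  using exec.Load[of W x a y "fst s" "snd s"] by simp

lemma exec_Store:
  "exec W (Store a x y) s 1 (fst s, (snd s)(a := (snd s a)(fst s x := fst s y)))"
  using exec.Store[of W a x y "fst s" "snd s"] by simp

text \<open>A strict bound on the register names that occur, hence the number of registers to reset
  before a run.\<close>

primrec reg_bound :: "com \<Rightarrow> nat" where
  "reg_bound Skip = 0"
| "reg_bound (Const x c) = Suc x"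
| "reg_bound (Arith x p y z) = Max {Suc x, Suc y, Suc z}"
| "reg_bound (Load x a y) = max (Suc x) (Suc y)"
| "reg_bound (Store a x y) = max (Suc x) (Suc y)"
| "reg_bound (Seq c1 c2) = max (reg_bound c1) (reg_bound c2)"
| "reg_bound (If x c1 c2) = Max {Suc x, reg_bound c1, reg_bound c2}"
| "reg_bound (While x c) = max (Suc x) (reg_bound c)"

text \<open>
  Register \<open>x\<close> of the simulated program is register \<open>x + 5\<close>.  Its array \<open>a\<close> is held in three arrays:
  \<open>3 * a\<close> with the initial contents, \<open>3 * a + 1\<close> with the written values and \<open>3 * a + 2\<close> with the
  stamps.  Register 1 holds the number of the current run and register 2 is scratch space; registers
  0, 3 and 4 are left to the caller.
\<close>

primrec stamped :: "com \<Rightarrow> com" where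
  "stamped Skip = Skip"
| "stamped (Const x c) = Const (x + 5) c"
| "stamped (Arith x p y z) = Arith (x + 5) p (y + 5) (z + 5)"
| "stamped (Load x a y) =
     Seq (Load 2 (3 * a + 2) (y + 5)) (Seq (Arith 2 Sub 1 2)
       (If 2 (Load (x + 5) (3 * a) (y + 5)) (Load (x + 5) (3 * a + 1) (y + 5))))"
| "stamped (Store a x y) =
     Seq (Store (3 * a + 1) (x + 5) (y + 5)) (Store (3 * a + 2) (x + 5) 1)"
| "stamped (Seq c1 c2) = Seq (stamped c1) (stamped c2)"
| "stamped (If x c1 c2) = If (x + 5) (stamped c1) (stamped c2)"
| "stamped (While x c) = While (x + 5) (stamped c)"

text \<open>Registers are matched only below \<open>M\<close>, arrays everywhere. Bounding the
  stamps by the run number lets a truncated subtraction test whether a stamp is current.\<close>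

definition simulates :: "nat \<Rightarrow> state \<Rightarrow> state \<Rightarrow> bool" where
  "simulates M s q \<longleftrightarrow>
     (\<forall>x < M. fst q (x + 5) = fst s x) \<and>
     (\<forall>a k. snd q (3 * a + 2) k \<le> fst q 1) \<and>
     (\<forall>a k. snd s a k =
        (if snd q (3 * a + 2) k = fst q 1 then snd q (3 * a + 1) k else snd q (3 * a) k))"

text \<open>What simulated code must preserve: the run number, the registers of the caller and the
  initial array contents. Scratch register 2 is left out.\<close>

definition same_frame :: "state \<Rightarrow> state \<Rightarrow> bool" where
  "same_frame q q' \<longleftrightarrow> (\<forall>x \<in> {0, 1, 3, 4}. fst q' x = fst q x) \<and> (\<forall>a. snd q' (3 * a) = snd q (3 * a))"

lemma same_frame_refl: "same_frame q q"
  by (simp add: same_frame_def)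

lemma same_frame_trans: "same_frame q q' \<Longrightarrow> same_frame q' q'' \<Longrightarrow> same_frame q q''"
  by (simp add: same_frame_def)

lemma array_residues:
  fixes a b :: nat
  shows "3 * a \<noteq> 3 * b + 1" "3 * a \<noteq> 3 * b + 2" "3 * a + 1 \<noteq> 3 * b + 2" "3 * a + 2 \<noteq> 3 * b + 1"
  by presburger+

text \<open>Reading the stamp, subtracting, testing and loading take one step each; this is the
  source of the factor 4. The bound on the run number keeps the difference below
  \<open>W\<close>.\<close>

lemma exec_stamped_Load:
  assumes sim: "simulates M (r, m) q" and x: "x < M" and y: "y < M" and run: "fst q 1 < W"
  obtains q' where "exec W (stamped (Load x a y)) q 4 q'"
    and "simulates M (r(x := m a (r y)), m) q'" and "same_frame q q'"
proof -
  \<comment> \<open>As stamps never exceed the run number, \<open>d = 0\<close> exactly if the stamp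
    is current.\<close>
  define d where "d = fst q 1 - snd q (3 * a + 2) (r y)"
  define q1 where "q1 = ((fst q)(2 := snd q (3 * a + 2) (r y)), snd q)"
  define q2 where "q2 = ((fst q)(2 := d), snd q)"
  define b where "b = (if d \<noteq> 0 then 3 * a else 3 * a + 1)"
  define q' where "q' = ((fst q2)(x + 5 := snd q2 b (fst q2 (y + 5))), snd q2)"
  have ry: "fst q (y + 5) = r y"
    using sim y by (simp add: simulates_def)
  have e1: "exec W (Load 2 (3 * a + 2) (y + 5)) q 1 q1"
    using exec_Load[of W 2 "3 * a + 2" "y + 5" q] by (simp only: q1_def ry)
  have e2: "exec W (Arith 2 Sub 1 2) q1 1 q2"
    using exec_Arith[of Sub q1 1 2 W 2] run
    by (simp add: q1_def q2_def d_def less_imp_diff_less)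
  have load: "exec W (Load (x + 5) b (y + 5)) q2 1 q'"
    unfolding q'_def by (rule exec_Load)
  have d: "fst q2 2 = d"
    by (simp add: q2_def)
  have e3: "exec W (If 2 (Load (x + 5) (3 * a) (y + 5)) (Load (x + 5) (3 * a + 1) (y + 5)))
      q2 (1 + 1) q'"
  proof (cases "d = 0")
    case True
    with load have "exec W (Load (x + 5) (3 * a + 1) (y + 5)) q2 1 q'"
      by (simp add: b_def)
    with True d show ?thesis
      by (intro exec.IfFalse) simp_all
  next
    case False
    with load have "exec W (Load (x + 5) (3 * a) (y + 5)) q2 1 q'"
      by (simp add: b_def)
    with False d show ?thesis
      by (intro exec.IfTrue) simp_all
  qed
  have "exec W (stamped (Load x a y)) q 4 q'"
    using exec.Seq[OF e1 exec.Seq[OF e2 e3]] by (simp add: eval_nat_numeral)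
  moreover have "snd q b (r y) = m a (r y)"
  proof -
    have "snd q (3 * a + 2) (r y) \<le> fst q 1"
      and "m a (r y) = (if snd q (3 * a + 2) (r y) = fst q 1 then snd q (3 * a + 1) (r y)
        else snd q (3 * a) (r y))"
      using sim by (simp_all add: simulates_def)
    then show ?thesis
      by (auto simp: b_def d_def)
  qed
  then have "simulates M (r(x := m a (r y)), m) q'"
    using sim ry by (auto simp: simulates_def q'_def q2_def)
  moreover have "same_frame q q'"
    by (simp add: same_frame_def q'_def q2_def)
  ultimately show thesis
    using that by blast
qed

lemma exec_stamped_Store:
  assumes sim: "simulates M (r, m) q" and x: "x < M" and y: "y < M"
  obtains q' where "exec W (stamped (Store a x y)) q 2 q'"
    and "simulates M (r, m(a := (m a)(r x := r y))) q'" and "same_frame q q'"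
proof -
  define q1 where "q1 = (fst q, (snd q)(3 * a + 1 := (snd q (3 * a + 1))(r x := r y)))"
  define q' where "q' = (fst q1, (snd q1)(3 * a + 2 := (snd q1 (3 * a + 2))(r x := fst q 1)))"
  have r: "fst q (x + 5) = r x" "fst q (y + 5) = r y"
    using sim x y by (simp_all add: simulates_def)
  have e1: "exec W (Store (3 * a + 1) (x + 5) (y + 5)) q 1 q1"
    using exec_Store[of W "3 * a + 1" "x + 5" "y + 5" q] by (simp only: q1_def r)
  have e2: "exec W (Store (3 * a + 2) (x + 5) 1) q1 1 q'"
    using exec_Store[of W "3 * a + 2" "x + 5" 1 q1]
    by (simp only: q1_def q'_def r fst_conv)
  have "exec W (stamped (Store a x y)) q 2 q'"
    using exec.Seq[OF e1 e2] by (simp only: stamped.simps one_add_one)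
  moreover have written: "snd q' (3 * b) = snd q (3 * b)"
    "snd q' (3 * b + 1) k = (if b = a \<and> k = r x then r y else snd q (3 * b + 1) k)"
    "snd q' (3 * b + 2) k = (if b = a \<and> k = r x then fst q 1 else snd q (3 * b + 2) k)" for b k
    using array_residues[of b a] array_residues[of a b] by (auto simp: q'_def q1_def)
  have regs: "fst q' = fst q"
    by (simp add: q'_def q1_def)
  have "simulates M (r, m(a := (m a)(r x := r y))) q'"
    using sim unfolding simulates_def written regs by simp
  moreover have "same_frame q q'"
    by (simp add: same_frame_def written regs)
  ultimately show thesis
    using that by blast
qed

text \<open>Induction on the simulated execution. Control flow is copied at equal cost and each
  instruction costs at most 4 steps; \<open>same_frame\<close> carries the bound on the run number
  from one piece of code to the next.\<close>

lemma exec_stamped: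
  assumes "exec W c s t s'" and "reg_bound c \<le> M" and "W \<le> W'"
    and "simulates M s q" and "fst q 1 < W'"
  shows "\<exists>t' q'. exec W' (stamped c) q t' q' \<and> t' \<le> 4 * t \<and> simulates M s' q' \<and> same_frame q q'"
  using assms
proof (induction arbitrary: q rule: exec.induct)
  case (Skip s)
  then show ?case
    using exec.Skip same_frame_refl by (intro exI[of _ 1] exI[of _ q]) simp
next
  case (Const c x r m)
  then have "simulates M (r(x := c), m) ((fst q)(x + 5 := c), snd q)"
    by (auto simp: simulates_def)
  moreover have "same_frame q ((fst q)(x + 5 := c), snd q)"
    by (simp add: same_frame_def)
  ultimately show ?case
    using exec_Const[of c W' "x + 5" q] Const.hyps Const.prems(2)
    by (intro exI[of _ 1] exI[of _ "((fst q)(x + 5 := c), snd q)"] conjI) simp_all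
next
  case (Arith p r y z x m)
  let ?v = "arith p (r y) (r z)"
  have eq: "fst q (y + 5) = r y" "fst q (z + 5) = r z"
    using Arith.prems by (auto simp: simulates_def)
  have "simulates M (r(x := ?v), m) ((fst q)(x + 5 := ?v), snd q)"
    using Arith.prems by (auto simp: simulates_def)
  moreover have "same_frame q ((fst q)(x + 5 := ?v), snd q)"
    by (simp add: same_frame_def)
  moreover have "exec W' (stamped (Arith x p y z)) q 1 ((fst q)(x + 5 := ?v), snd q)"
    using exec_Arith[of p q "y + 5" "z + 5" W' "x + 5"] Arith.hyps Arith.prems(2)
    by (simp only: stamped.simps eq)
  ultimately show ?case
    by (intro exI[of _ 1] exI[of _ "((fst q)(x + 5 := ?v), snd q)"] conjI) simp_all
next
  case (Load x a y r m)
  then have "x < M" "y < M"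
    by simp_all
  from exec_stamped_Load[OF Load.prems(3) this Load.prems(4)]
  obtain q' where "exec W' (stamped (Load x a y)) q 4 q'"
    "simulates M (r(x := m a (r y)), m) q'" "same_frame q q'"
    by blast
  then show ?case
    by (intro exI[of _ 4] exI[of _ q']) simp
next
  case (Store a x y r m)
  then have "x < M" "y < M"
    by simp_all
  from exec_stamped_Store[OF Store.prems(3) this]
  obtain q' where "exec W' (stamped (Store a x y)) q 2 q'"
    "simulates M (r, m(a := (m a)(r x := r y))) q'" "same_frame q q'"
    by blast
  then show ?case
    by (intro exI[of _ 2] exI[of _ q']) simp
next
  case (Seq c1 s t1 s1 c2 t2 s2)
  obtain u1 q1 where 1: "exec W' (stamped c1) q u1 q1" "u1 \<le> 4 * t1" "simulates M s1 q1"
    "same_frame q q1"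
    using Seq.IH(1)[of q] Seq.prems by auto
  moreover have "fst q1 1 < W'"
    using 1(4) Seq.prems by (simp add: same_frame_def)
  ultimately obtain u2 q2 where "exec W' (stamped c2) q1 u2 q2" "u2 \<le> 4 * t2" "simulates M s2 q2"
    "same_frame q1 q2"
    using Seq.IH(2)[of q1] Seq.prems by auto
  with 1 show ?case
    using exec.Seq[of W' "stamped c1" q u1 q1 "stamped c2" u2 q2] same_frame_trans
    by (intro exI[of _ "u1 + u2"] exI[of _ q2]) auto
next
  case (IfTrue s x c1 t s' c2)
  obtain u q' where "exec W' (stamped c1) q u q'" "u \<le> 4 * t" "simulates M s' q'" "same_frame q q'"
    using IfTrue.IH[of q] IfTrue.prems by auto
  moreover have "fst q (x + 5) \<noteq> 0"
    using IfTrue.hyps(1) IfTrue.prems by (simp add: simulates_def)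
  ultimately show ?case
    using exec.IfTrue[of q "x + 5" W' "stamped c1" u q']
    by (intro exI[of _ "u + 1"] exI[of _ q']) auto
next
  case (IfFalse s x c2 t s' c1)
  obtain u q' where "exec W' (stamped c2) q u q'" "u \<le> 4 * t" "simulates M s' q'" "same_frame q q'"
    using IfFalse.IH[of q] IfFalse.prems by auto
  moreover have "fst q (x + 5) = 0"
    using IfFalse.hyps(1) IfFalse.prems by (simp add: simulates_def)
  ultimately show ?case
    using exec.IfFalse[of q "x + 5" W' "stamped c2" u q']
    by (intro exI[of _ "u + 1"] exI[of _ q']) auto
next
  case (WhileFalse s x c)
  then have "fst q (x + 5) = 0"
    by (simp add: simulates_def)
  then show ?case
    using exec.WhileFalse[of q "x + 5" W' "stamped c"] WhileFalse.prems same_frame_refl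
    by (intro exI[of _ 1] exI[of _ q]) auto
next
  case (WhileTrue s x c t1 s1 t2 s2)
  obtain u1 q1 where 1: "exec W' (stamped c) q u1 q1" "u1 \<le> 4 * t1" "simulates M s1 q1"
    "same_frame q q1"
    using WhileTrue.IH(1)[of q] WhileTrue.prems by auto
  moreover have "fst q1 1 < W'"
    using 1(4) WhileTrue.prems by (simp add: same_frame_def)
  ultimately obtain u2 q2 where "exec W' (stamped (While x c)) q1 u2 q2" "u2 \<le> 4 * t2"
    "simulates M s2 q2" "same_frame q1 q2"
    using WhileTrue.IH(2)[of q1] WhileTrue.prems by auto
  moreover have "fst q (x + 5) \<noteq> 0"
    using WhileTrue.hyps(1) WhileTrue.prems by (simp add: simulates_def)
  ultimately show ?case
    using 1 exec.WhileTrue[of q "x + 5" W' "stamped c" u1 q1 u2 q2] same_frame_trans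
    by (intro exI[of _ "u1 + u2 + 1"] exI[of _ q2]) auto
qed

section \<open>Testing all vertices\<close>

text \<open>The loop is unrolled when the program is built, so its cost depends on the program alone
  and not on the input.\<close>

primrec clear :: "nat \<Rightarrow> com" where
  "clear 0 = Skip"
| "clear (Suc n) = Seq (clear n) (Const (n + 5) 0)"

lemma exec_clear:
  assumes "0 < W"
  shows "exec W (clear M) s (M + 1) (\<lambda>x. if 5 \<le> x \<and> x < M + 5 then 0 else fst s x, snd s)"
proof (induction M)
  case 0
  have "(\<lambda>x. if 5 \<le> x \<and> x < 0 + 5 then 0 else fst s x, snd s) = s"
    by (cases s) auto
  then show ?case
    using exec.Skip[of W s] by (simp del: add_0)
next
  case (Suc M)
  have "(\<lambda>x. if 5 \<le> x \<and> x < M + 5 then 0 else fst s x)(M + 5 := 0) =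
      (\<lambda>x. if 5 \<le> x \<and> x < Suc M + 5 then 0 else fst s x)"
    by auto
  then show ?case
    using exec.Seq[OF Suc exec_Const[OF assms, of "M + 5"]] by simp
qed

text \<open>
  Register 0 holds the number \<open>n\<close> of vertices, register 3 the number of remaining runs, and
  register 4 is set once a run has answered no.
\<close>

definition prepare :: "nat \<Rightarrow> com" where
  "prepare M = Seq (clear M) (Seq (Const 2 0) (Seq (Arith 5 Add 0 2) (Seq (Arith 6 Add 1 2)
     (Seq (Const 2 1) (Arith 1 Add 1 2)))))"

definition finish :: com where
  "finish = Seq (If 5 Skip (Const 4 1)) (Arith 3 Sub 0 1)"

definition test_all :: "nat \<Rightarrow> com \<Rightarrow> com" where
  "test_all M c =
     Seq (Arith 3 Add 0 2) (Seq (While 3 (Seq (prepare M) (Seq (stamped c) finish)))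
       (If 4 (Const 0 0) (Const 0 1)))"

text \<open>Vertex \<open>i\<close> is tested in run \<open>Suc i\<close>; numbering runs from 1
  makes the initial stamps 0 out of date. Raising the run number thus restores all arrays at once,
  and only the registers need to be reset.\<close>

lemma exec_prepare:
  assumes n: "fst q 0 = n" and i: "fst q 1 = i" "i < n" and W: "n < W" and M: "2 \<le> M"
    and stamps: "\<And>a k. snd q (3 * a + 2) k \<le> i"
    and init: "\<And>a. snd q (3 * a) = ((\<lambda>a i. 0)(0 := A)) a"
  obtains q' where "exec W (prepare M) q (M + 6) q'" and "simulates M (initial_state [n, i] A) q'"
    and "fst q' 0 = n" and "fst q' 1 = Suc i" and "fst q' 4 = fst q 4" and "snd q' = snd q"
proof -
  define r where "r = (\<lambda>x. if 5 \<le> x \<and> x < M + 5 then 0 else fst q x)"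
  define q' where "q' = (r(2 := 0, 5 := n, 6 := i, 2 := 1, 1 := Suc i), snd q)"
  have r: "r 0 = n" "r 1 = i" "r 4 = fst q 4" and r0: "\<And>x. x < M \<Longrightarrow> r (x + 5) = 0"
    using n i by (auto simp: r_def)
  have e1: "exec W (clear M) q (M + 1) (r, snd q)"
    unfolding r_def using W by (intro exec_clear) auto
  have e2: "exec W (Const 2 0) (r, snd q) 1 (r(2 := 0), snd q)"
    by (rule exec.Const) (use W in auto)
  \<comment> \<open>Adding register 2, which holds 0, acts as a copy instruction.\<close>
  have e3: "exec W (Arith 5 Add 0 2) (r(2 := 0), snd q) 1 (r(2 := 0, 5 := n), snd q)"
    using exec_Arith[of Add "(r(2 := 0), snd q)" 0 2 W 5] r W by simp
  have e4: "exec W (Arith 6 Add 1 2) (r(2 := 0, 5 := n), snd q) 1 (r(2 := 0, 5 := n, 6 := i), snd q)"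
    using exec_Arith[of Add "(r(2 := 0, 5 := n), snd q)" 1 2 W 6] r W i by simp
  have e5: "exec W (Const 2 1) (r(2 := 0, 5 := n, 6 := i), snd q) 1
      (r(2 := 0, 5 := n, 6 := i, 2 := 1), snd q)"
    by (rule exec.Const) (use W i in auto)
  have e6: "exec W (Arith 1 Add 1 2) (r(2 := 0, 5 := n, 6 := i, 2 := 1), snd q) 1 q'"
    using exec_Arith[of Add "(r(2 := 0, 5 := n, 6 := i, 2 := 1), snd q)" 1 2 W 1] r W i
    by (simp add: q'_def)
  have "exec W (prepare M) q (M + 6) q'"
    unfolding prepare_def
    using exec.Seq[OF e1 exec.Seq[OF e2 exec.Seq[OF e3 exec.Seq[OF e4 exec.Seq[OF e5 e6]]]]]
    by (simp add: eval_nat_numeral)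
  moreover have "fst q' (x + 5) = array_of [n, i] x" if "x < M" for x
  proof -
    consider "x = 0" | "x = 1" | "2 \<le> x"
      by linarith
    then show ?thesis
    proof cases
      case 3
      with r0[OF that] show ?thesis
        by (simp add: q'_def array_of_def)
    qed (simp_all add: q'_def array_of_def)
  qed
  \<comment> \<open>No cell carries the new run number, so every simulated cell shows its initial
    content.\<close>
  moreover have "snd q (3 * a + 2) k \<le> Suc i" "snd q (3 * a + 2) k \<noteq> Suc i" for a k
    using stamps[of a k] by auto
  ultimately show thesis
    using that[of q'] init r by (simp add: simulates_def initial_state_def q'_def)
qed

text \<open>Register 5 is the simulated answer register. Register 4 is never reset here, so a
  negative answer persists.\<close>

lemma exec_finish:
  assumes W: "fst q 0 < W" "1 < W"
  obtains t q' where "exec W finish q t q'" and "t \<le> 3"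
    and "fst q' = (fst q)(4 := if fst q 5 = 0 then 1 else fst q 4, 3 := fst q 0 - fst q 1)"
    and "snd q' = snd q"
proof -
  define q1 where "q1 = ((fst q)(4 := if fst q 5 = 0 then 1 else fst q 4), snd q)"
  define q' where "q' = ((fst q1)(3 := fst q 0 - fst q 1), snd q)"
  have e1: "exec W (If 5 Skip (Const 4 1)) q (1 + 1) q1"
  proof (cases "fst q 5 = 0")
    case True
    then show ?thesis
      using exec.IfFalse[OF True exec_Const[OF W(2), of 4 q], of Skip] by (simp add: q1_def)
  next
    case False
    then show ?thesis
      using exec.IfTrue[OF False exec.Skip[of W q], of "Const 4 1"] by (simp add: q1_def)
  qed
  have e2: "exec W (Arith 3 Sub 0 1) q1 1 q'"
    using exec_Arith[of Sub q1 0 1 W 3] W by (simp add: q1_def q'_def less_imp_diff_less)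
  show thesis
    using that[of "1 + 1 + 1" q'] exec.Seq[OF e1 e2] by (simp add: finish_def q'_def q1_def)
qed

section \<open>The loop over all vertices\<close>

context
  fixes W W' n M T :: nat and c :: com and A :: "nat \<Rightarrow> nat" and Q :: "nat \<Rightarrow> bool"
  assumes W: "W \<le> W'" "n < W'" and M: "2 \<le> M" "reg_bound c \<le> M"
    and runs: "\<And>i. i < n \<Longrightarrow>
      \<exists>t s. exec W c (initial_state [n, i] A) t s \<and> t \<le> T \<and> (fst s 0 \<noteq> 0 \<longleftrightarrow> Q i)"
begin

text \<open>Describes the state after \<open>i\<close> completed runs. The bound on the stamps makes
  the next run number fresh.\<close>

definition loop_invariant :: "nat \<Rightarrow> state \<Rightarrow> bool" where
  "loop_invariant i q \<longleftrightarrow>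
     fst q 0 = n \<and> fst q 1 = i \<and> i \<le> n \<and> fst q 3 = n - i \<and> (fst q 4 = 0 \<longleftrightarrow> (\<forall>j < i. Q j)) \<and>
     (\<forall>a k. snd q (3 * a + 2) k \<le> i) \<and> (\<forall>a. snd q (3 * a) = ((\<lambda>a i. 0)(0 := A)) a)"

lemma exec_loop_body:
  assumes inv: "loop_invariant i q" and i: "i < n"
  obtains t q' where "exec W' (Seq (prepare M) (Seq (stamped c) finish)) q t q'"
    and "t \<le> M + 9 + 4 * T" and "loop_invariant (Suc i) q'"
proof -
  obtain q1 where q1: "exec W' (prepare M) q (M + 6) q1" "simulates M (initial_state [n, i] A) q1"
    "fst q1 0 = n" "fst q1 1 = Suc i" "fst q1 4 = fst q 4" "snd q1 = snd q"
    using exec_prepare[of q n i W' M A] inv i W(2) M(1) unfolding loop_invariant_def by blast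
  obtain t s where s: "exec W c (initial_state [n, i] A) t s" "t \<le> T" "fst s 0 \<noteq> 0 \<longleftrightarrow> Q i"
    using runs[OF i] by blast
  obtain u q2 where q2: "exec W' (stamped c) q1 u q2" "u \<le> 4 * t" "simulates M s q2"
    "same_frame q1 q2"
    using exec_stamped[OF s(1) M(2) W(1) q1(2)] q1(4) W(2) i by auto
  have q2': "fst q2 0 = n" "fst q2 1 = Suc i" "fst q2 4 = fst q 4" "\<And>a. snd q2 (3 * a) = snd q (3 * a)"
    using q1 q2(4) by (simp_all add: same_frame_def)
  obtain v q3 where q3: "exec W' finish q2 v q3" "v \<le> 3" "snd q3 = snd q2"
    "fst q3 = (fst q2)(4 := if fst q2 5 = 0 then 1 else fst q2 4, 3 := fst q2 0 - fst q2 1)"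
  proof -
    have "fst q2 0 < W'" "1 < W'"
      using q2'(1) W(2) i by linarith+
    then show thesis
      using exec_finish that by blast
  qed
  \<comment> \<open>\<open>M\<close> is at least 2, so \<open>simulates\<close> covers register
    0.\<close>
  have "fst q2 5 = fst s 0"
    using q2(3) M(1) unfolding simulates_def by (metis add_0 less_le_trans pos2)
  moreover have "(\<forall>j < Suc i. Q j) \<longleftrightarrow> (\<forall>j < i. Q j) \<and> Q i"
    by (auto simp: less_Suc_eq)
  moreover have "snd q2 (3 * a + 2) k \<le> Suc i" for a k
    using q2(3) q2'(2) by (simp add: simulates_def)
  ultimately have "loop_invariant (Suc i) q3"
    using inv i q2' s(3) q3(3,4) unfolding loop_invariant_def by auto
  moreover have "M + 6 + (u + v) \<le> M + 9 + 4 * T"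
    using q2(2) q3(2) s(2) by simp
  ultimately show thesis
    using that exec.Seq[OF q1(1) exec.Seq[OF q2(1) q3(1)]] by blast
qed

text \<open>Each round pays one step for the loop test on top of its body; the final
  \<open>+ 1\<close> is the failing test.\<close>

lemma exec_loop:
  assumes "loop_invariant i q"
  shows "\<exists>t q'. exec W' (While 3 (Seq (prepare M) (Seq (stamped c) finish))) q t q' \<and>
    t \<le> (n - i) * (M + 10 + 4 * T) + 1 \<and> loop_invariant n q'"
  using assms
proof (induction "n - i" arbitrary: i q)
  case 0
  then have "fst q 3 = 0" "i = n"
    by (auto simp: loop_invariant_def)
  then show ?case
    using 0 exec.WhileFalse[of q 3 W'] by (intro exI[of _ 1] exI[of _ q]) simp
next
  case (Suc d)
  let ?body = "Seq (prepare M) (Seq (stamped c) finish)"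
  have i: "i < n" "fst q 3 \<noteq> 0"
    using Suc.hyps(2) Suc.prems by (auto simp: loop_invariant_def)
  obtain t q1 where 1: "exec W' ?body q t q1" "t \<le> M + 9 + 4 * T" "loop_invariant (Suc i) q1"
    using exec_loop_body[OF Suc.prems i(1)] by blast
  obtain u q2 where 2: "exec W' (While 3 ?body) q1 u q2"
    "u \<le> (n - Suc i) * (M + 10 + 4 * T) + 1" "loop_invariant n q2"
    using Suc.hyps(1)[OF _ 1(3)] Suc.hyps(2) by (metis Suc_diff_Suc i(1) nat.inject)
  have "n - i = Suc (n - Suc i)"
    using i(1) by simp
  then have "t + u + 1 \<le> (n - i) * (M + 10 + 4 * T) + 1"
    using 1(2) 2(2) by simp
  then show ?case
    using exec.WhileTrue[of q 3, OF i(2) 1(1) 2(1)] 2(3) by blast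
qed

lemma exec_test_all:
  assumes "1 < W'"
  shows "\<exists>t q. exec W' (test_all M c) (initial_state [n] A) t q \<and>
    t \<le> n * (M + 10 + 4 * T) + 4 \<and> (fst q 0 \<noteq> 0 \<longleftrightarrow> (\<forall>i < n. Q i))"
proof -
  define q0 where "q0 = initial_state [n] A"
  define q1 where "q1 = ((fst q0)(3 := n), snd q0)"
  have q0: "fst q0 = array_of [n]" "snd q0 = (\<lambda>a i. 0)(0 := A)"
    by (simp_all add: q0_def initial_state_def)
  have regs: "array_of [n] 0 = n" "\<And>x. x \<noteq> 0 \<Longrightarrow> array_of [n] x = 0"
    by (simp_all add: array_of_def)
  have e1: "exec W' (Arith 3 Add 0 2) q0 1 q1"
    using exec_Arith[of Add q0 0 2 W' 3] W(2) by (simp add: q0 q1_def regs)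
  \<comment> \<open>The input already lies where the initial content of simulated array 0 is kept,
    and all stamps are 0.\<close>
  have "loop_invariant 0 q1"
    by (auto simp: loop_invariant_def q1_def q0 regs)
  then obtain t q2 where q2:
    "exec W' (While 3 (Seq (prepare M) (Seq (stamped c) finish))) q1 t q2"
    "t \<le> n * (M + 10 + 4 * T) + 1" "loop_invariant n q2"
    using exec_loop[of 0 q1] by auto
  define b where "b = (if fst q2 4 = 0 then 1 else 0 :: nat)"
  have e3: "exec W' (If 4 (Const 0 0) (Const 0 1)) q2 (1 + 1) ((fst q2)(0 := b), snd q2)"
  proof (cases "fst q2 4 = 0")
    case True
    then show ?thesis
      using exec.IfFalse[OF True exec_Const[OF assms, of 0 q2], of "Const 0 0"]
      by (simp add: b_def)
  next
    case False
    then show ?thesis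
      using exec.IfTrue[OF False exec_Const[of 0 W' 0 q2], of "Const 0 1"] assms
      by (simp add: b_def)
  qed
  have "exec W' (test_all M c) q0 (1 + (t + (1 + 1))) ((fst q2)(0 := b), snd q2)"
    unfolding test_all_def by (intro exec.Seq[OF e1] exec.Seq[OF q2(1)] e3)
  moreover have "b \<noteq> 0 \<longleftrightarrow> (\<forall>i < n. Q i)"
    using q2(3) by (simp add: b_def loop_invariant_def)
  ultimately show ?thesis
    using q2(2) unfolding q0_def
    by (intro exI[of _ "1 + (t + (1 + 1))"] exI[of _ "((fst q2)(0 := b), snd q2)"]) simp
qed

end

text \<open>Gives \<open>1 \<le> T n\<close> for nonempty graphs, which absorbs the constant
  overhead per vertex into a multiple of \<open>T n\<close>.\<close>

lemma exec_time_pos: "exec W c s t s' \<Longrightarrow> 0 < t"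
  by (induction rule: exec.induct) auto

theorem theorem3p2:
  fixes F :: "'a ugraph set" and f :: "nat \<Rightarrow> real" and fmt :: graph_format
  assumes "\<forall>G \<in> F. simple_graph G"
    and "hereditary F"
    and "solvable_in_time (shedding_problem fmt F) f"
  shows "solvable_in_time (W2_problem fmt {G \<in> F. well_covered G}) (\<lambda>n. real n * f n)"
proof -
  obtain P k T where T: "(\<lambda>n. real (T n)) \<in> O(f)"
    and P: "\<And>n s b. (n, s, b) \<in> shedding_problem fmt F \<Longrightarrow>
      \<exists>t s'. exec ((n + 2) ^ k) P s t s' \<and> t \<le> T n \<and> (fst s' 0 \<noteq> 0 \<longleftrightarrow> b)"
    using assms(3) unfolding solvable_in_time_def by blast
  define M where "M = max 2 (reg_bound P)"
  \<comment> \<open>On the empty graph the product would be 0 although the program takes steps;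
    changing this single value does not affect the growth rate.\<close>
  define T' where "T' = (\<lambda>n. if n = 0 then 4 else (M + 18) * (n * T n))"
  have "(\<lambda>n. real (T' n)) \<in> O(\<lambda>n. real n * f n)"
  proof -
    have "(\<lambda>n. real (M + 18) * (real n * real (T n))) \<in> O(\<lambda>n. real n * f n)"
      by (intro landau_o.big.cmult_in_iff[THEN iffD2] landau_o.big.mult T) auto
    moreover have "\<forall>\<^sub>F n in at_top. real (M + 18) * (real n * real (T n)) = real (T' n)"
      using eventually_gt_at_top[of 0] by eventually_elim (simp add: T'_def)
    ultimately show ?thesis
      by (simp only: landau_o.big.in_cong)
  qed
  moreover have "\<exists>t s'. exec ((n + 2) ^ (k + 1)) (test_all M P) s t s' \<and> t \<le> T' n \<and>
      (fst s' 0 \<noteq> 0 \<longleftrightarrow> b)"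
    if "(n, s, b) \<in> W2_problem fmt {G \<in> F. well_covered G}" for n s b
  proof -
    obtain G vs A where G: "G \<in> F" "well_covered G" "enumerates vs G" "represents fmt G vs A"
      and eq: "n = card (verts G)" "s = initial_state [n] A" "b = W2 G"
      using \<open>(n, s, b) \<in> _\<close> unfolding W2_problem_def by auto
    have len: "length vs = n"
      using G(3) eq(1) by (metis distinct_card enumerates_def)
    \<comment> \<open>For each \<open>i\<close>, the same \<open>vs\<close> and \<open>A\<close>
      form an instance of the shedding problem.\<close>
    have runs: "\<exists>t s. exec ((n + 2) ^ k) P (initial_state [n, i] A) t s \<and> t \<le> T n \<and>
        (fst s 0 \<noteq> 0 \<longleftrightarrow> shedding G (vs ! i))" if "i < n" for i
      by (rule P) (unfold shedding_problem_def eq(1), use G that len eq(1) in blast)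
    have "(n + 2) ^ k \<le> (n + 2) ^ (k + 1)"
      by (rule power_increasing) auto
    \<comment> \<open>The exponent \<open>k + 1\<close> leaves room for the run numbers even if
      \<open>k = 0\<close>.\<close>
    moreover have "n + 2 \<le> (n + 2) ^ (k + 1)"
      using power_increasing[of 1 "k + 1" "n + 2"] by simp
    then have "n < (n + 2) ^ (k + 1)" "1 < (n + 2) ^ (k + 1)"
      by linarith+
    moreover have "2 \<le> M" "reg_bound P \<le> M"
      by (simp_all add: M_def)
    ultimately obtain t q where q: "exec ((n + 2) ^ (k + 1)) (test_all M P) s t q"
      "t \<le> n * (M + 10 + 4 * T n) + 4" "fst q 0 \<noteq> 0 \<longleftrightarrow> (\<forall>i < n. shedding G (vs ! i))"
      unfolding eq(2) using exec_test_all[OF _ _ _ _ runs] by blast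
    have "t \<le> T' n"
    proof (cases "n = 0")
      case False
      then have "1 \<le> T n"
        using runs[of 0] exec_time_pos by fastforce
      then have "M + 10 + 4 * T n + 4 \<le> (M + 18) * T n"
        by (simp add: add_mult_distrib)
          (metis One_nat_def add_mono mult.right_neutral mult_le_mono2 numeral_eq_Suc)
      then have "n * (M + 10 + 4 * T n + 4) \<le> n * ((M + 18) * T n)"
        by simp
      \<comment> \<open>Moves the additive 4 of the whole program into the cost per vertex.\<close>
      moreover have "4 \<le> n * 4"
        using False by simp
      ultimately show ?thesis
        using q(2) False by (simp add: T'_def algebra_simps)
    qed (use q(2) in \<open>simp add: T'_def\<close>)
    moreover have "W2 G \<longleftrightarrow> (\<forall>i < n. shedding G (vs ! i))"
      using W2_iff_shedding[OF _ G(2)] assms(1) G(1,3) len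
      unfolding enumerates_def by (metis all_set_conv_all_nth)
    ultimately show ?thesis
      using q eq(3) by blast
  qed
  ultimately show ?thesis
    unfolding solvable_in_time_def by blast
qed

end
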